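(* Let $A_i\subset\mathbb{R}^n$ $(i=1,\dots,n)$ be compact convex sets whose interiors are non-empty. Then there exists some $\mathbf{u}=(u,u_{n+1})\in S^n$ such that, for all $i=1,\dots,n$, both $A_i\cap H_{\mathbf{u}}^+$ and $A_i\cap H_{\mathbf{u}}^-$ are non-empty and $$\delta^*(u\mid A_i\cap H_{\mathbf{u}}^+)-\delta_*(u\mid A_i\cap H_{\mathbf{u}}^+)=\delta^*(u\mid A_i\cap H_{\mathbf{u}}^-)-\delta_*(u\mid A_i\cap H_{\mathbf{u}}^-),$$ where $\delta^*(u\mid X):=\max_{x\in X}\langle u,x\rangle$ and $\delta_*(u\mid X):=\min_{x\in X}\langle u,x\rangle$ denote the support function and the infimum support function, respectively.
   Context: $S^n$ is the unit sphere in $\mathbb{R}^{n+1}$. A point $\mathbf{u}=(u_1,\dots,u_n,u_{n+1})\in S^n$ is written $\mathbf{u}=(u,u_{n+1})$ with $u=(u_1,\dots,u_n)\in\mathbb{R}^n$, and $H_{\mathbf{u}}^+=\{x\in\mathbb{R}^n\mid\langle u,x\rangle\ge u_{n+1}\}$, $H_{\mathbf{u}}^-=\{x\in\mathbb{R}^n\mid\langle u,x\rangle\le u_{n+1}\}$, where $\langle\cdot,\cdot\rangle$ is the standard inner product of $\mathbb{R}^n$. (If $u=0$, one of these two sets is $\mathbb{R}^n$ and the other is empty.) *)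

theory Defs
  imports "HOL-Analysis.Analysis"
begin

text \<open>
  \<open>\<real>\<^sup>n\<^sup>+\<^sup>1\<close> is \<open>\<real>\<^sup>n \<times> \<real>\<close>, whose library norm is the Euclidean one,
  \<open>norm (u, t) = sqrt (norm u ^ 2 + \<bar>t\<bar> ^ 2)\<close>; so \<open>S\<^sup>n\<close> is \<open>sphere (0, 0) 1\<close>.
\<close>

definition halfspace_pos :: "(real ^ 'n) \<times> real \<Rightarrow> (real ^ 'n) set"
  where "halfspace_pos uu = {x. fst uu \<bullet> x \<ge> snd uu}"

definition halfspace_neg :: "(real ^ 'n) \<times> real \<Rightarrow> (real ^ 'n) set"
  where "halfspace_neg uu = {x. fst uu \<bullet> x \<le> snd uu}"

text \<open>
  The maximum and minimum of \<open>u \<bullet> x\<close> over \<open>X\<close>. They exist for \<open>X\<close> compact and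
  non-empty, and are unspecified when they do not exist.
\<close>

definition support_max :: "real ^ 'n \<Rightarrow> (real ^ 'n) set \<Rightarrow> real"
  where "support_max u X = (GREATEST t. t \<in> (\<lambda>x. u \<bullet> x) ` X)"

definition support_min :: "real ^ 'n \<Rightarrow> (real ^ 'n) set \<Rightarrow> real"
  where "support_min u X = (LEAST t. t \<in> (\<lambda>x. u \<bullet> x) ` X)"

lemma support_max_eqI:
  assumes "x \<in> X" "\<And>y. y \<in> X \<Longrightarrow> u \<bullet> y \<le> u \<bullet> x"
  shows "support_max u X = u \<bullet> x"
  unfolding support_max_def by (rule Greatest_equality) (use assms in auto)

lemma support_min_eqI:
  assumes "x \<in> X" "\<And>y. y \<in> X \<Longrightarrow> u \<bullet> x \<le> u \<bullet> y"
  shows "support_min u X = u \<bullet> x"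
  unfolding support_min_def by (rule Least_equality) (use assms in auto)

lemma support_max_attained:
  assumes "compact X" "X \<noteq> {}"
  obtains x where "x \<in> X" "support_max u X = u \<bullet> x" "\<And>y. y \<in> X \<Longrightarrow> u \<bullet> y \<le> u \<bullet> x"
proof -
  have "continuous_on X (\<lambda>x. u \<bullet> x)" by (intro continuous_intros)
  from continuous_attains_sup[OF assms this] show ?thesis
    using support_max_eqI that by metis
qed

lemma support_min_attained:
  assumes "compact X" "X \<noteq> {}"
  obtains x where "x \<in> X" "support_min u X = u \<bullet> x" "\<And>y. y \<in> X \<Longrightarrow> u \<bullet> x \<le> u \<bullet> y"
proof -
  have "continuous_on X (\<lambda>x. u \<bullet> x)" by (intro continuous_intros)
  from continuous_attains_inf[OF assms this] show ?thesis
    using support_min_eqI that by metis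
qed

end

theory Submission
  imports Defs "HOL-Library.Z2"
begin

text \<open>
  For a direction \<open>u \<noteq> 0\<close> put \<open>m\<^sub>i(u) = (max + min) / 2\<close>, where the maximum and minimum of
  \<open>\<langle>u, x\<rangle>\<close> are taken over \<open>A\<^sub>i\<close>. The hyperplane \<open>\<langle>u, x\<rangle> = m\<^sub>i(u)\<close> meets \<open>A\<^sub>i\<close>, because \<open>A\<^sub>i\<close> is
  convex, and so it cuts the width of \<open>A\<^sub>i\<close> in direction \<open>u\<close> into two equal parts. Hence it is
  enough to find \<open>u\<close> at which all \<open>m\<^sub>i(u)\<close> agree; the pair \<open>(u, m\<^sub>i(u))\<close> is then rescaled to
  lie on \<open>S\<^sup>n\<close>. The functions \<open>m\<^sub>i\<close> are continuous and odd, so for a fixed index \<open>j\<close> the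
  \<open>n - 1\<close> differences \<open>m\<^sub>i - m\<^sub>j\<close> have a common zero on \<open>S\<^sup>n\<^sup>-\<^sup>1\<close> by the Borsuk--Ulam theorem
  (\<open>borsuk_ulam_common_zero\<close>).

  The Borsuk--Ulam theorem is proved here by Ky Fan's parity argument, on the boundary of the
  cross-polytope. Suppose that \<open>m\<close> odd functions \<open>f\<^sub>i\<close> have no common zero there. By compactness
  some \<open>\<bar>f\<^sub>i(x)\<bar>\<close> is always at least a fixed \<open>\<epsilon>\<close>; label \<open>x\<close> with the first such \<open>i\<close> and the
  sign of \<open>f\<^sub>i(x)\<close>. Antipodal points receive the same index and opposite signs. On a simplex of
  small diameter no index occurs with both signs. Call a simplex alternating if the signs
  alternate when its vertices are sorted by index; a small alternating simplex then has pairwise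
  distinct indices, hence at most \<open>m\<close> vertices. The contradiction comes from the fact that in
  every iterated barycentric subdivision of a \<open>k\<close>-dimensional hemisphere of the cross-polytope
  the number of alternating simplices is odd (\<open>alternating_simplex_exists\<close>).

  That count is algebra modulo 2. Let \<open>p\<close> be the cochain that is 1 exactly on simplices which
  alternate and start with the sign \<open>+\<close>. Then \<open>\<delta>p = p + p \<circ> \<tau>\<close>, \<open>\<tau>\<close> being the antipodal map
  (\<open>coboundary_alternating_sorted_signs\<close>), and \<open>p + p \<circ> \<tau>\<close> counts all alternating simplices.
  The \<open>(k + 1)\<close>-dimensional hemisphere \<open>h\<close> satisfies \<open>\<partial>h = h' + \<tau>h'\<close> for the \<open>k\<close>-dimensional
  hemisphere \<open>h'\<close> (\<open>sum_hemisphere_coboundary\<close>), and subdivision is a chain map that commutes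
  with \<open>\<tau>\<close>. So the parity is the same for \<open>h\<close> and \<open>h'\<close>, and in dimension 0 it is 1.

  A simplex is a list of points and a chain is a list of simplices. Simplices may degenerate or
  overlap, since chains enter only through the sums of cochains over them.
\<close>

(* Keeps sums modulo 2 in the language of abelian groups instead of Boolean xor. *)
declare add_bit_eq_xor [simp del]

section \<open>Mod 2 cochains on lists of points\<close>

fun faces :: "'a list \<Rightarrow> 'a list list" where
  "faces [] = []"
| "faces (x # xs) = xs # map ((#) x) (faces xs)"

lemma length_faces: "\<tau> \<in> set (faces \<sigma>) \<Longrightarrow> Suc (length \<tau>) = length \<sigma>"
  by (induction \<sigma> arbitrary: \<tau>) auto

lemma set_faces: "\<tau> \<in> set (faces \<sigma>) \<Longrightarrow> set \<tau> \<subseteq> set \<sigma>"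
  by (induction \<sigma> arbitrary: \<tau>) fastforce+

lemma faces_map: "faces (map f \<sigma>) = map (map f) (faces \<sigma>)"
  by (induction \<sigma>) auto

text \<open>
  The empty list is a face of each vertex, so this is the augmented complex. This makes the
  identities below hold for all lists, with no separate treatment of low dimensions.
\<close>

definition coboundary :: "('a list \<Rightarrow> bit) \<Rightarrow> 'a list \<Rightarrow> bit" where
  "coboundary g \<sigma> = (\<Sum>\<tau>\<leftarrow>faces \<sigma>. g \<tau>)"

lemma coboundary_Nil [simp]: "coboundary g [] = 0"
  by (simp add: coboundary_def)

lemma coboundary_Cons [simp]:
  "coboundary g (x # xs) = g xs + coboundary (\<lambda>\<tau>. g (x # \<tau>)) xs"
  by (simp add: coboundary_def o_def)

lemma coboundary_add: "coboundary (\<lambda>\<sigma>. g \<sigma> + h \<sigma>) \<sigma> = coboundary g \<sigma> + coboundary h \<sigma>"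
  by (simp add: coboundary_def sum_list_addf)

lemma coboundary_map: "coboundary (\<lambda>\<tau>. g (map f \<tau>)) \<sigma> = coboundary g (map f \<sigma>)"
  by (simp add: coboundary_def faces_map o_def)

lemma bit_add_self: "(x :: bit) + x = 0"
  by (cases x) simp_all

lemma coboundary_coboundary: "coboundary (coboundary g) \<sigma> = 0"
proof (induction \<sigma> arbitrary: g)
  case (Cons x xs)
  show ?case by (simp add: coboundary_add Cons add.assoc[symmetric] bit_add_self)
qed simp

section \<open>Barycentric subdivision\<close>

definition barycenter :: "'a::real_vector list \<Rightarrow> 'a" where
  "barycenter \<sigma> = sum_list \<sigma> /\<^sub>R real (length \<sigma>)"

function subdivision :: "'a::real_vector list \<Rightarrow> 'a list list" where
  "subdivision \<sigma> = (if \<sigma> = [] then [[]]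
     else concat (map (\<lambda>\<rho>. map ((#) (barycenter \<sigma>)) (subdivision \<rho>)) (faces \<sigma>)))"
  by pat_completeness auto
termination
  by (relation "inv_image less_than length") (auto dest: length_faces)

declare subdivision.simps [simp del]

lemma sum_list_concat_map:
  "(\<Sum>y\<leftarrow>concat (map F xs). g y) = (\<Sum>x\<leftarrow>xs. \<Sum>y\<leftarrow>F x. g y)"
  by (induction xs) auto

text \<open>
  Subdividing a simplex is coning the subdivided boundary from the barycenter, here in dual form.
\<close>

lemma sum_subdivision:
  assumes "\<sigma> \<noteq> []"
  shows "(\<Sum>\<tau>\<leftarrow>subdivision \<sigma>. g \<tau>) =
         coboundary (\<lambda>\<rho>. \<Sum>\<tau>\<leftarrow>subdivision \<rho>. g (barycenter \<sigma> # \<tau>)) \<sigma>"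
  using assms
  by (subst subdivision.simps) (simp add: sum_list_concat_map coboundary_def o_def)

text \<open>
  Subdivision is a chain map. Only the cone structure matters, not the position of the apex: the
  coboundary of \<open>g\<close> on the cone over \<open>\<tau>\<close> is \<open>g \<tau>\<close> plus the coboundary of the coned cochain \<open>?h\<close>,
  and the latter contributes a double coboundary by the induction hypothesis.
\<close>

lemma sum_subdivision_coboundary:
  "(\<Sum>\<tau>\<leftarrow>subdivision \<sigma>. coboundary g \<tau>) = coboundary (\<lambda>\<rho>. \<Sum>\<tau>\<leftarrow>subdivision \<rho>. g \<tau>) \<sigma>"
proof (induction "length \<sigma>" arbitrary: \<sigma> g rule: less_induct)
  case less
  show ?case
  proof (cases "\<sigma> = []")
    case True
    then show ?thesis by (simp add: subdivision.simps)
  next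
    case False
    let ?S = "\<lambda>g \<rho>. \<Sum>\<tau>\<leftarrow>subdivision \<rho>. g \<tau>"
    let ?h = "\<lambda>\<tau>. g (barycenter \<sigma> # \<tau>)"
    have "?S (coboundary g) \<sigma> = coboundary (?S (\<lambda>\<tau>. g \<tau> + coboundary ?h \<tau>)) \<sigma>"
      by (simp add: sum_subdivision[OF False])
    also have "\<dots> = coboundary (?S g) \<sigma> + coboundary (?S (coboundary ?h)) \<sigma>"
      by (simp add: sum_list_addf coboundary_add)
    also have "coboundary (?S (coboundary ?h)) \<sigma> = coboundary (coboundary (?S ?h)) \<sigma>"
      unfolding coboundary_def[of _ \<sigma>]
      by (intro arg_cong[of _ _ sum_list] map_cong refl less) (auto dest: length_faces)
    finally show ?thesis by (simp add: coboundary_coboundary)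
  qed
qed

lemma subdivision_uminus:
  "subdivision (map uminus \<sigma>) = map (map uminus) (subdivision \<sigma>)"
proof (induction "length \<sigma>" arbitrary: \<sigma> rule: less_induct)
  case less
  have b: "barycenter (map uminus \<sigma>) = - barycenter \<sigma>"
    using uminus_sum_list_map[of "\<lambda>x. x" \<sigma>]
    by (simp add: barycenter_def o_def flip: scaleR_minus_right)
  have "subdivision (map uminus \<rho>) = map (map uminus) (subdivision \<rho>)"
    if "\<rho> \<in> set (faces \<sigma>)" for \<rho>
    using that by (intro less) (auto dest: length_faces)
  then show ?case
    by (subst (1 2) subdivision.simps)
       (auto simp: faces_map b map_concat o_def intro!: arg_cong[of _ _ concat])
qed

lemma subdivision_Nil [simp]: "subdivision [] = [[]]"
  by (simp add: subdivision.simps)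

lemma in_subdivisionE:
  assumes "\<tau> \<in> set (subdivision \<sigma>)" "\<sigma> \<noteq> []"
  obtains \<rho> \<tau>' where "\<rho> \<in> set (faces \<sigma>)" "\<tau>' \<in> set (subdivision \<rho>)" "\<tau> = barycenter \<sigma> # \<tau>'"
proof -
  have "\<tau> \<in> set (concat (map (\<lambda>\<rho>. map ((#) (barycenter \<sigma>)) (subdivision \<rho>)) (faces \<sigma>)))"
    using assms by (simp only: subdivision.simps[of \<sigma>] if_False)
  then show ?thesis using that by auto
qed

lemma length_subdivision: "\<tau> \<in> set (subdivision \<sigma>) \<Longrightarrow> length \<tau> = length \<sigma>"
proof (induction "length \<sigma>" arbitrary: \<sigma> \<tau> rule: less_induct)
  case less
  show ?case
  proof (cases "\<sigma> = []")
    case True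
    then show ?thesis using less(2) by simp
  next
    case False
    then obtain \<rho> \<tau>' where *: "\<rho> \<in> set (faces \<sigma>)" "\<tau>' \<in> set (subdivision \<rho>)" "\<tau> = barycenter \<sigma> # \<tau>'"
      using in_subdivisionE[OF less(2)] by metis
    then have "Suc (length \<rho>) = length \<sigma>" by (intro length_faces)
    moreover from this have "length \<tau>' = length \<rho>" by (intro less(1) *) simp
    ultimately show ?thesis using * by simp
  qed
qed

lemma barycenter_in_hull:
  assumes "\<sigma> \<noteq> []"
  shows "barycenter \<sigma> \<in> convex hull (set \<sigma>)"
proof -
  have "barycenter \<sigma> = (\<Sum>i<length \<sigma>. (1 / real (length \<sigma>)) *\<^sub>R \<sigma> ! i)"
    by (simp add: barycenter_def sum_list_sum_nth scaleR_sum_right atLeast0LessThan divide_inverse)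
  also have "\<dots> \<in> convex hull (set \<sigma>)"
    using assms by (intro convex_sum) (auto intro: hull_inc)
  finally show ?thesis .
qed

lemma subdivision_subset_hull:
  "\<tau> \<in> set (subdivision \<sigma>) \<Longrightarrow> set \<tau> \<subseteq> convex hull (set \<sigma>)"
proof (induction "length \<sigma>" arbitrary: \<sigma> \<tau> rule: less_induct)
  case less
  show ?case
  proof (cases "\<sigma> = []")
    case True
    then show ?thesis using less(2) by simp
  next
    case False
    then obtain \<rho> \<tau>' where *: "\<rho> \<in> set (faces \<sigma>)" "\<tau>' \<in> set (subdivision \<rho>)" "\<tau> = barycenter \<sigma> # \<tau>'"
      using in_subdivisionE[OF less(2)] by metis
    have "set \<tau>' \<subseteq> convex hull (set \<rho>)"
      using * by (intro less) (auto dest: length_faces)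
    also have "\<dots> \<subseteq> convex hull (set \<sigma>)"
      using * by (intro hull_mono set_faces)
    finally show ?thesis using * barycenter_in_hull[OF False] by auto
  qed
qed

text \<open>
  The factor \<open>(n - 1) / n\<close>, with \<open>n\<close> the number of vertices, arises because one of the \<open>n\<close> terms
  averaged in \<open>barycenter \<sigma> - v\<close> vanishes.
\<close>

lemma dist_barycenter_le:
  fixes v :: "'a::real_normed_vector"
  assumes v: "v \<in> set \<sigma>" and d: "\<And>w. w \<in> set \<sigma> \<Longrightarrow> dist w v \<le> d"
  shows "dist (barycenter \<sigma>) v \<le> (real (length \<sigma>) - 1) / real (length \<sigma>) * d"
proof -
  obtain ys zs where s: "\<sigma> = ys @ v # zs" using v by (meson split_list)
  have n: "real (length \<sigma>) > 0" using v by auto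
  have le: "norm (sum_list xs - real (length xs) *\<^sub>R v) \<le> real (length xs) * d"
    if "set xs \<subseteq> set \<sigma>" for xs
    using that
  proof (induction xs)
    case (Cons x xs)
    have "sum_list (x # xs) - real (length (x # xs)) *\<^sub>R v
        = (x - v) + (sum_list xs - real (length xs) *\<^sub>R v)"
      by (simp add: algebra_simps)
    also have "norm \<dots> \<le> d + real (length xs) * d"
      using Cons d[of x] by (intro norm_triangle_le add_mono) (auto simp: dist_norm)
    finally show ?case by (simp add: algebra_simps)
  qed simp
  have "sum_list (ys @ zs) - real (length (ys @ zs)) *\<^sub>R v = sum_list \<sigma> - real (length \<sigma>) *\<^sub>R v"
    by (simp add: s algebra_simps)
  then have "(sum_list (ys @ zs) - real (length (ys @ zs)) *\<^sub>R v) /\<^sub>R real (length \<sigma>) = barycenter \<sigma> - v"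
    using n by (simp add: barycenter_def scaleR_right_diff_distrib del: sum_list_append length_append)
  then have "dist (barycenter \<sigma>) v = norm ((sum_list (ys @ zs) - real (length (ys @ zs)) *\<^sub>R v) /\<^sub>R real (length \<sigma>))"
    by (simp only: dist_norm)
  also have "\<dots> = norm (sum_list (ys @ zs) - real (length (ys @ zs)) *\<^sub>R v) / real (length \<sigma>)"
    using n by (simp only: norm_scaleR) (simp add: divide_inverse)
  also have "\<dots> \<le> real (length (ys @ zs)) * d / real (length \<sigma>)"
    by (intro divide_right_mono le) (auto simp: s)
  finally show ?thesis by (simp add: s)
qed

text \<open>
  Two vertices of a subdivided simplex either lie in the subdivision of a proper face, where the
  contraction factor is even smaller, or one of them is the barycenter, and the ball around the
  barycenter that contains all vertices contains their convex hull.
\<close>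

lemma subdivision_dist_le:
  fixes \<sigma> :: "'a::real_normed_vector list"
  assumes "\<tau> \<in> set (subdivision \<sigma>)"
    and "\<And>v w. v \<in> set \<sigma> \<Longrightarrow> w \<in> set \<sigma> \<Longrightarrow> dist v w \<le> d"
    and "x \<in> set \<tau>" "y \<in> set \<tau>"
  shows "dist x y \<le> (real (length \<sigma>) - 1) / real (length \<sigma>) * d"
  using assms
proof (induction "length \<sigma>" arbitrary: \<sigma> \<tau> x y rule: less_induct)
  case less
  let ?r = "(real (length \<sigma>) - 1) / real (length \<sigma>) * d"
  have ne: "\<sigma> \<noteq> []" using length_subdivision[OF less(2)] less(4) by auto
  then obtain \<rho> \<tau>' where *: "\<rho> \<in> set (faces \<sigma>)" "\<tau>' \<in> set (subdivision \<rho>)" "\<tau> = barycenter \<sigma> # \<tau>'"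
    using in_subdivisionE[OF less(2)] by metis
  have d0: "d \<ge> 0" using less(3)[of "hd \<sigma>" "hd \<sigma>"] ne by simp
  have r0: "?r \<ge> 0" using d0 ne by (cases \<sigma>) auto
  have "set \<sigma> \<subseteq> cball (barycenter \<sigma>) ?r"
    using dist_barycenter_le[of _ \<sigma> d] less(3) by auto
  then have "convex hull (set \<sigma>) \<subseteq> cball (barycenter \<sigma>) ?r"
    by (intro hull_minimal) auto
  then have b: "dist (barycenter \<sigma>) z \<le> ?r" if "z \<in> set \<tau>" for z
    using subdivision_subset_hull[OF less(2)] that by auto
  have in': "dist z z' \<le> ?r" if "z \<in> set \<tau>'" "z' \<in> set \<tau>'" for z z'
  proof -
    have l: "Suc (length \<rho>) = length \<sigma>" using * length_faces by blast
    have pos: "length \<rho> > 0" using length_subdivision[OF *(2)] that by auto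
    have "dist z z' \<le> (real (length \<rho>) - 1) / real (length \<rho>) * d"
      by (rule less(1)[OF _ *(2) _ that]) (use l set_faces[OF *(1)] less(3) in auto)
    also have "\<dots> \<le> ?r"
      using pos l[symmetric] d0 by (intro mult_right_mono) (auto simp: field_simps)
    finally show ?thesis .
  qed
  consider "x = barycenter \<sigma>" | "y = barycenter \<sigma>" | "x \<in> set \<tau>'" "y \<in> set \<tau>'"
    using less(4,5) *(3) by auto
  then show ?case
  proof cases
    case 1
    then show ?thesis using b[OF less(5)] by (simp only:)
  next
    case 2
    then show ?thesis using b[OF less(4)] by (simp only: dist_commute)
  next
    case 3
    then show ?thesis by (rule in')
  qed
qed

fun iterated_subdivision :: "nat \<Rightarrow> 'a::real_vector list \<Rightarrow> 'a list list" where
  "iterated_subdivision 0 \<sigma> = [\<sigma>]"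
| "iterated_subdivision (Suc N) \<sigma> = concat (map subdivision (iterated_subdivision N \<sigma>))"

lemma sum_iterated_subdivision_coboundary:
  "(\<Sum>\<tau>\<leftarrow>iterated_subdivision N \<sigma>. coboundary g \<tau>)
     = coboundary (\<lambda>\<rho>. \<Sum>\<tau>\<leftarrow>iterated_subdivision N \<rho>. g \<tau>) \<sigma>"
  by (induction N arbitrary: g) (simp_all add: sum_list_concat_map sum_subdivision_coboundary)

lemma iterated_subdivision_uminus:
  "iterated_subdivision N (map uminus \<sigma>) = map (map uminus) (iterated_subdivision N \<sigma>)"
  by (induction N) (simp_all add: map_concat o_def subdivision_uminus)

lemma length_iterated_subdivision:
  "\<tau> \<in> set (iterated_subdivision N \<sigma>) \<Longrightarrow> length \<tau> = length \<sigma>"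
  by (induction N arbitrary: \<tau>) (auto dest: length_subdivision)

lemma iterated_subdivision_subset_hull:
  "\<tau> \<in> set (iterated_subdivision N \<sigma>) \<Longrightarrow> set \<tau> \<subseteq> convex hull (set \<sigma>)"
proof (induction N arbitrary: \<tau>)
  case (Suc N)
  then obtain \<rho> where "\<rho> \<in> set (iterated_subdivision N \<sigma>)" "\<tau> \<in> set (subdivision \<rho>)"
    by auto
  then show ?case
    using Suc.IH[of \<rho>] subdivision_subset_hull[of \<tau> \<rho>] hull_minimal[of "set \<rho>" "convex hull set \<sigma>" convex]
    by auto
qed (simp add: hull_subset)

lemma iterated_subdivision_dist_le:
  fixes \<sigma> :: "'a::real_normed_vector list"
  assumes "\<tau> \<in> set (iterated_subdivision N \<sigma>)"
    and "\<And>v w. v \<in> set \<sigma> \<Longrightarrow> w \<in> set \<sigma> \<Longrightarrow> dist v w \<le> d"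
    and "x \<in> set \<tau>" "y \<in> set \<tau>"
  shows "dist x y \<le> ((real (length \<sigma>) - 1) / real (length \<sigma>)) ^ N * d"
  using assms(1,3,4)
proof (induction N arbitrary: \<tau> x y)
  case 0
  then show ?case using assms(2) by simp
next
  case (Suc N)
  then obtain \<rho> where \<rho>: "\<rho> \<in> set (iterated_subdivision N \<sigma>)" "\<tau> \<in> set (subdivision \<rho>)"
    by auto
  show ?case
    using subdivision_dist_le[OF \<rho>(2) Suc.IH[OF \<rho>(1)] Suc.prems(2,3)]
      length_iterated_subdivision[OF \<rho>(1)] by (simp add: mult.assoc)
qed

section \<open>The hemispheres of the cross-polytope\<close>

text \<open>
  The upper hemisphere of dimension \<open>k + 1\<close> is the cone from \<open>e (k + 1)\<close> over the whole sphere of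
  dimension \<open>k\<close>, which consists of a hemisphere and its antipode. Its simplices are those with vertices \<open>e k\<close>, \<open>\<plusminus> e (k - 1)\<close>, \<dots>, \<open>\<plusminus> e 0\<close>.
\<close>

fun hemisphere :: "(nat \<Rightarrow> 'a::real_vector) \<Rightarrow> nat \<Rightarrow> 'a list list" where
  "hemisphere e 0 = [[e 0]]"
| "hemisphere e (Suc k) =
     map ((#) (e (Suc k))) (hemisphere e k @ map (map uminus) (hemisphere e k))"

text \<open>
  The boundary of a hemisphere is the sphere one dimension lower: coning gives back its base up to
  the cone over the boundary of the base, and that boundary vanishes because, by induction, it is
  a sum of two antipodal hemispheres taken twice.
\<close>

lemma sum_hemisphere_coboundary:
  "(\<Sum>\<sigma>\<leftarrow>hemisphere e (Suc k). coboundary g \<sigma>)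
     = (\<Sum>\<sigma>\<leftarrow>hemisphere e k. g \<sigma> + g (map uminus \<sigma>))"
proof (induction k arbitrary: g)
  case 0
  show ?case by (simp add: ac_simps)
next
  case (Suc k)
  define H where "H = hemisphere e (Suc k)"
  let ?h = "\<lambda>\<tau>. g (e (Suc (Suc k)) # \<tau>)"
  have "(\<Sum>\<sigma>\<leftarrow>hemisphere e (Suc (Suc k)). coboundary g \<sigma>)
      = (\<Sum>\<sigma>\<leftarrow>H. g \<sigma> + g (map uminus \<sigma>))
        + ((\<Sum>\<sigma>\<leftarrow>H. coboundary ?h \<sigma>) + (\<Sum>\<sigma>\<leftarrow>H. coboundary (\<lambda>\<tau>. ?h (map uminus \<tau>)) \<sigma>))"
    unfolding hemisphere.simps(2)[of e "Suc k"] H_def[symmetric]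
    by (simp add: o_def sum_list_addf coboundary_map[of ?h uminus] ac_simps)
  also have "(\<Sum>\<sigma>\<leftarrow>H. coboundary (\<lambda>\<tau>. ?h (map uminus \<tau>)) \<sigma>) = (\<Sum>\<sigma>\<leftarrow>H. coboundary ?h \<sigma>)"
    unfolding H_def Suc.IH by (simp add: o_def add.commute)
  finally show ?case by (simp add: H_def bit_add_self del: hemisphere.simps)
qed

lemma length_hemisphere: "\<sigma> \<in> set (hemisphere e k) \<Longrightarrow> length \<sigma> = Suc k"
  by (induction k arbitrary: \<sigma>) auto

text \<open>
  The boundary of the cross-polytope. Simplices of the hemispheres lie flat in it, so the
  subdivision can be done with straight lines, away from the origin and inside a compact set.
\<close>

definition cross_polytope :: "'a::euclidean_space set" where
  "cross_polytope = {x. (\<Sum>b\<in>Basis. \<bar>x \<bullet> b\<bar>) = 1}"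

lemma norm_cross_polytope: "x \<in> cross_polytope \<Longrightarrow> norm x \<le> 1"
  using norm_le_l1[of x] by (simp add: cross_polytope_def)

lemma compact_cross_polytope: "compact (cross_polytope :: 'a::euclidean_space set)"
proof -
  have "closed (cross_polytope :: 'a set)"
    unfolding cross_polytope_def by (intro closed_Collect_eq continuous_intros)
  moreover have "bounded (cross_polytope :: 'a set)"
    using norm_cross_polytope by (auto simp: bounded_iff)
  ultimately show ?thesis by (simp add: compact_eq_bounded_closed)
qed

lemma hemisphere_signs:
  fixes e :: "nat \<Rightarrow> 'a::real_vector"
  assumes "inj_on e {..k}" "\<sigma> \<in> set (hemisphere e k)"
  shows "\<exists>w. (\<forall>b. w b = 1 \<or> w b = (-1::real)) \<and> set \<sigma> \<subseteq> (\<lambda>b. w b *\<^sub>R b) ` e ` {..k}"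
  using assms
proof (induction k arbitrary: \<sigma>)
  case 0
  then show ?case by (intro exI[of _ "\<lambda>_. 1"]) auto
next
  case (Suc k)
  obtain \<rho> where "\<rho> \<in> set (hemisphere e k)"
    "\<sigma> = e (Suc k) # \<rho> \<or> \<sigma> = e (Suc k) # map uminus \<rho>"
    using Suc.prems(2) by auto
  moreover have "map ((*\<^sub>R) 1) \<rho> = \<rho>" "map ((*\<^sub>R) (-1)) \<rho> = map uminus \<rho>"
    by (simp_all add: map_idI)
  ultimately obtain s where \<rho>: "\<rho> \<in> set (hemisphere e k)"
    "s = 1 \<or> s = (-1::real)" "\<sigma> = e (Suc k) # map ((*\<^sub>R) s) \<rho>"
    by metis
  obtain w where w: "\<forall>b. w b = 1 \<or> w b = (-1::real)" "set \<rho> \<subseteq> (\<lambda>b. w b *\<^sub>R b) ` e ` {..k}"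
    using Suc.IH[OF _ \<rho>(1)] Suc.prems(1) by (auto simp: atMost_Suc)
  have ne: "e j \<noteq> e (Suc k)" if "j \<le> k" for j
    using inj_onD[OF Suc.prems(1), of j "Suc k"] that by auto
  show ?case
  proof (intro exI conjI)
    show "\<forall>b. ((\<lambda>b. s * w b)(e (Suc k) := 1)) b = 1 \<or> ((\<lambda>b. s * w b)(e (Suc k) := 1)) b = -1"
      using w(1) \<rho>(2) by auto
    show "set \<sigma> \<subseteq> (\<lambda>b. ((\<lambda>b. s * w b)(e (Suc k) := 1)) b *\<^sub>R b) ` e ` {..Suc k}"
    proof
      fix v assume "v \<in> set \<sigma>"
      then consider "v = e (Suc k)" | u where "u \<in> set \<rho>" "v = s *\<^sub>R u"
        using \<rho>(3) by auto
      then show "v \<in> (\<lambda>b. ((\<lambda>b. s * w b)(e (Suc k) := 1)) b *\<^sub>R b) ` e ` {..Suc k}"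
      proof cases
        case 1
        then show ?thesis by (auto simp: image_iff)
      next
        case 2
        then obtain j where "j \<le> k" "u = w (e j) *\<^sub>R e j" using w(2) by auto
        then show ?thesis using 2 ne[of j] by (auto simp: image_iff intro!: bexI[of _ j])
      qed
    qed
  qed
qed

lemma hull_hemisphere_subset_cross_polytope:
  fixes e :: "nat \<Rightarrow> 'a::euclidean_space"
  assumes "inj_on e {..k}" "e ` {..k} \<subseteq> Basis" "\<sigma> \<in> set (hemisphere e k)"
  shows "convex hull (set \<sigma>) \<subseteq> cross_polytope"
proof -
  obtain w where w: "\<And>b. w b = 1 \<or> w b = (-1::real)" "set \<sigma> \<subseteq> (\<lambda>b. w b *\<^sub>R b) ` e ` {..k}"
    using hemisphere_signs[OF assms(1,3)] by auto
  \<comment> \<open>the facet in the orthant with signs \<open>w\<close>\<close>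
  define Q where "Q = {x::'a. (\<forall>b\<in>Basis. 0 \<le> w b * (x \<bullet> b)) \<and> (\<Sum>b\<in>Basis. w b * (x \<bullet> b)) = 1}"
  have "convex Q"
    unfolding convex_def Q_def
  proof (clarsimp, intro conjI ballI)
    fix x y :: 'a and u v :: real and b :: 'a
    assume *: "\<forall>b\<in>Basis. 0 \<le> w b * (x \<bullet> b)" "\<forall>b\<in>Basis. 0 \<le> w b * (y \<bullet> b)"
      "0 \<le> u" "0 \<le> v" "b \<in> Basis"
    have "0 \<le> u * (w b * (x \<bullet> b)) + v * (w b * (y \<bullet> b))" using * by simp
    then show "0 \<le> w b * ((u *\<^sub>R x + v *\<^sub>R y) \<bullet> b)" by (simp add: algebra_simps)
  next
    fix x y :: 'a and u v :: real
    assume *: "(\<Sum>b\<in>Basis. w b * (x \<bullet> b)) = 1" "(\<Sum>b\<in>Basis. w b * (y \<bullet> b)) = 1" "u + v = 1"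
    have "(\<Sum>b\<in>Basis. w b * ((u *\<^sub>R x + v *\<^sub>R y) \<bullet> b))
        = u * (\<Sum>b\<in>Basis. w b * (x \<bullet> b)) + v * (\<Sum>b\<in>Basis. w b * (y \<bullet> b))"
      by (simp add: sum_distrib_left sum.distrib[symmetric] algebra_simps)
    then show "(\<Sum>b\<in>Basis. w b * ((u *\<^sub>R x + v *\<^sub>R y) \<bullet> b)) = 1" using * by simp
  qed
  moreover have "w b *\<^sub>R b \<in> Q" if "b \<in> Basis" for b
  proof -
    have ww: "w b * w b = 1" using w(1)[of b] by auto
    have "(\<Sum>c\<in>Basis. w c * (w b *\<^sub>R b \<bullet> c)) = (\<Sum>c\<in>Basis. if c = b then w b * w b else 0)"
      using that by (intro sum.cong) (auto simp: inner_Basis)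
    then show ?thesis using that ww by (auto simp: Q_def inner_Basis)
  qed
  then have "set \<sigma> \<subseteq> Q" using w(2) assms(2) by blast
  ultimately have "convex hull (set \<sigma>) \<subseteq> Q" by (intro hull_minimal)
  moreover have "Q \<subseteq> cross_polytope"
  proof
    fix x assume x: "x \<in> Q"
    have "\<bar>x \<bullet> b\<bar> = w b * (x \<bullet> b)" if "b \<in> Basis" for b
      using x that w(1)[of b] by (auto simp: Q_def)
    then show "x \<in> cross_polytope" using x by (simp add: Q_def cross_polytope_def)
  qed
  ultimately show ?thesis by blast
qed

section \<open>Alternating simplices\<close>

fun alternating :: "bool \<Rightarrow> bool list \<Rightarrow> bool" where
  "alternating b [] \<longleftrightarrow> True"
| "alternating b (x # xs) \<longleftrightarrow> x = b \<and> alternating (\<not> b) xs"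

text \<open>
  In a nonempty alternating list, deleting an interior entry destroys the alternation, deleting
  the first one changes the initial sign and deleting the last one keeps it, so exactly one
  deletion gives an alternating list with initial sign \<open>b\<close>. Any other list with an alternating
  face has exactly one pair of equal neighbours; only deleting one of these two entries helps,
  and both deletions give the same face, so the count is 0 or 2.
\<close>

lemma coboundary_alternating:
  "coboundary (\<lambda>s. of_bool (alternating b s)) s
     = of_bool (alternating True s) + of_bool (alternating False s)"
proof (induction s arbitrary: b)
  case (Cons x xs)
  show ?case
  proof (cases "x = b")
    case True
    then show ?thesis
      by (cases "alternating True xs"; cases "alternating False xs"; cases b) (simp_all add: Cons)
  next
    case False
    then have "x = (\<not> b)" by auto
    then show ?thesis by (cases b) (simp_all add: coboundary_def o_def)
  qed
qed (simp add: bit_add_self)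

lemma alternating_map_Not: "alternating b (map Not s) = alternating (\<not> b) s"
  by (induction s arbitrary: b) auto

text \<open>
  Deleting an entry commutes with inserting another one into a sorted list. This also holds for
  equal keys, because the new entry is placed before the entries with the same key.
\<close>

lemma mset_faces_insort_key:
  assumes "sorted (map f ys)"
  shows "mset (faces (insort_key f x ys)) = add_mset ys (image_mset (insort_key f x) (mset (faces ys)))"
  using assms
proof (induction ys)
  case (Cons y ys)
  show ?case
  proof (cases "f x \<le> f y")
    case True
    have "insort_key f x \<tau> = x # \<tau>" if "\<tau> \<in> set (faces (y # ys))" for \<tau>
    proof (intro insort_is_Cons ballI)
      fix z assume "z \<in> set \<tau>"
      then have "z \<in> set (y # ys)" using set_faces[OF that] by blast
      then show "f x \<le> f z" using Cons.prems True by (auto intro: order_trans)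
    qed
    then have "image_mset (insort_key f x) (mset (faces (y # ys))) = image_mset ((#) x) (mset (faces (y # ys)))"
      by (intro image_mset_cong) (simp only: set_mset_mset)
    then show ?thesis using True by (simp add: multiset.map_comp)
  next
    case False
    then show ?thesis using Cons by (simp add: multiset.map_comp o_def)
  qed
qed simp

text \<open>
  Sorting only permutes the faces, and modulo 2 no orientation signs arise.
\<close>

lemma coboundary_sort_key:
  "coboundary (\<lambda>\<tau>. g (sort_key f \<tau>)) \<sigma> = coboundary g (sort_key f \<sigma>)"
proof -
  have "mset (map (sort_key f) (faces \<sigma>)) = mset (faces (sort_key f \<sigma>))"
  proof (induction \<sigma>)
    case (Cons x xs)
    have "mset (map (sort_key f) (faces (x # xs)))
        = add_mset (sort_key f xs) (image_mset (insort_key f x) (mset (map (sort_key f) (faces xs))))"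
      by (simp add: multiset.map_comp o_def)
    also have "mset (map (sort_key f) (faces xs)) = mset (faces (sort_key f xs))"
      by (rule Cons)
    finally show ?case by (simp add: mset_faces_insort_key)
  qed simp
  then have "mset (map g (map (sort_key f) (faces \<sigma>))) = mset (map g (faces (sort_key f \<sigma>)))"
    by (metis mset_map)
  from arg_cong[OF this, of sum_mset] show ?thesis
    by (simp only: coboundary_def sum_mset_sum_list map_map o_def)
qed

text \<open>
  A label is a pair of an index and a sign, standing for \<open>\<plusminus>1, \<plusminus>2, \<dots>\<close> in the usual
  formulation of Tucker's and Fan's lemmas.
\<close>

definition sorted_signs :: "('a \<Rightarrow> nat \<times> bool) \<Rightarrow> 'a list \<Rightarrow> bool list" where
  "sorted_signs l \<sigma> = map snd (sort_key fst (map l \<sigma>))"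

lemma coboundary_alternating_sorted_signs:
  "coboundary (\<lambda>\<tau>. of_bool (alternating b (sorted_signs l \<tau>))) \<sigma>
     = of_bool (alternating True (sorted_signs l \<sigma>)) + of_bool (alternating False (sorted_signs l \<sigma>))"
  unfolding sorted_signs_def
  using coboundary_map[of "\<lambda>\<tau>. of_bool (alternating b (map snd (sort_key fst \<tau>)))" l \<sigma>]
    coboundary_sort_key[of "\<lambda>\<tau>. of_bool (alternating b (map snd \<tau>))" fst "map l \<sigma>"]
    coboundary_map[of "\<lambda>\<tau>. of_bool (alternating b \<tau>)" snd "sort_key fst (map l \<sigma>)"]
  by (simp add: coboundary_alternating)

lemma sorted_signs_map_uminus:
  fixes l :: "'a::uminus \<Rightarrow> nat \<times> bool"
  assumes "\<And>x. x \<in> set \<sigma> \<Longrightarrow> l (- x) = (fst (l x), \<not> snd (l x))"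
  shows "sorted_signs l (map uminus \<sigma>) = map Not (sorted_signs l \<sigma>)"
proof -
  let ?n = "\<lambda>p::nat \<times> bool. (fst p, \<not> snd p)"
  have ins: "insort_key fst (?n p) (map ?n L) = map ?n (insort_key fst p L)" for p L
    by (induction L) auto
  have "sort_key fst (map ?n L) = map ?n (sort_key fst L)" for L
    by (induction L) (simp_all add: ins)
  moreover have "map l (map uminus \<sigma>) = map ?n (map l \<sigma>)"
    using assms by simp
  ultimately have "sort_key fst (map l (map uminus \<sigma>)) = map ?n (sort_key fst (map l \<sigma>))"
    by (simp only:)
  then show ?thesis
    unfolding sorted_signs_def by (simp add: o_def)
qed

text \<open>
  In a sorted list equal indices are adjacent, where alternation forces opposite signs; but no
  index occurs with both signs.
\<close>

lemma distinct_if_alternating: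
  assumes "sorted (map fst L)" "alternating b (map snd L)"
    and "\<And>i s. \<not> ((i, s) \<in> set L \<and> (i, \<not> s) \<in> set L)"
  shows "distinct (map fst (L :: (nat \<times> bool) list))"
  using assms
proof (induction L arbitrary: b)
  case (Cons p L)
  have IH: "distinct (map fst L)"
    using Cons.prems by (intro Cons.IH[of "\<not> b"]) auto
  show ?case
  proof (cases L)
    case (Cons q L')
    have "fst p \<noteq> fst q"
      using Cons.prems(2) Cons.prems(3)[of "fst p" "snd p"] Cons by (cases p; cases q) auto
    then show ?thesis using IH Cons.prems(1) Cons by fastforce
  qed simp
qed simp

text \<open>
  The parity \<open>count j\<close> of the number of alternating simplices in the \<open>N\<close>-th subdivision of the
  \<open>j\<close>-dimensional hemisphere does not depend on \<open>j\<close>, by duality between the boundary of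
  hemispheres and the coboundary of the alternating cochain. For \<open>j = 0\<close> there is one simplex, a
  single vertex, and it alternates. This is the parity argument of Ky Fan's lemma.
\<close>

lemma alternating_simplex_exists:
  fixes l :: "'a::real_vector \<Rightarrow> nat \<times> bool"
  assumes odd: "\<And>x. x \<in> S \<Longrightarrow> l (- x) = (fst (l x), \<not> snd (l x))"
    and S: "\<And>j \<sigma>. j \<le> k \<Longrightarrow> \<sigma> \<in> set (hemisphere e j) \<Longrightarrow> convex hull (set \<sigma>) \<subseteq> S"
  shows "\<exists>\<sigma>\<in>set (hemisphere e k). \<exists>\<tau>\<in>set (iterated_subdivision N \<sigma>). \<exists>b. alternating b (sorted_signs l \<tau>)"
proof -
  define alt :: "bool \<Rightarrow> 'a list \<Rightarrow> bit" where "alt = (\<lambda>b \<tau>. of_bool (alternating b (sorted_signs l \<tau>)))"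
  define G where "G = (\<lambda>b \<sigma>. \<Sum>\<tau>\<leftarrow>iterated_subdivision N \<sigma>. alt b \<tau>)"
  define count where "count = (\<lambda>j. \<Sum>\<sigma>\<leftarrow>hemisphere e j. G True \<sigma> + G False \<sigma>)"
  have "count j = 1" if "j \<le> k" for j
    using that
  proof (induction j)
    case 0
    have "subdivision [x] = [[x]]" for x :: 'a
      by (simp add: subdivision.simps barycenter_def)
    then have "iterated_subdivision N [x] = [[x]]" for x :: 'a
      by (induction N) auto
    then show ?case
      by (cases "snd (l (e 0))") (simp_all add: count_def G_def alt_def sorted_signs_def)
  next
    case (Suc j)
    have flip: "G True (map uminus \<sigma>) = G False \<sigma>" if \<sigma>: "\<sigma> \<in> set (hemisphere e j)" for \<sigma>
    proof -
      have "alt True (map uminus \<tau>) = alt False \<tau>" if "\<tau> \<in> set (iterated_subdivision N \<sigma>)" for \<tau>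
      proof -
        have "set \<tau> \<subseteq> S"
          using iterated_subdivision_subset_hull[OF that] S[OF _ \<sigma>] Suc.prems by auto
        then have "sorted_signs l (map uminus \<tau>) = map Not (sorted_signs l \<tau>)"
          by (intro sorted_signs_map_uminus odd) auto
        then show ?thesis by (simp add: alt_def alternating_map_Not)
      qed
      then show ?thesis
        unfolding G_def iterated_subdivision_uminus
        by (auto simp: o_def intro!: arg_cong[of _ _ sum_list])
    qed
    have "G True \<sigma> + G False \<sigma> = coboundary (G True) \<sigma>" for \<sigma>
      unfolding G_def sum_iterated_subdivision_coboundary[symmetric] sum_list_addf[symmetric]
      unfolding alt_def coboundary_alternating_sorted_signs ..
    then have "count (Suc j) = (\<Sum>\<sigma>\<leftarrow>hemisphere e (Suc j). coboundary (G True) \<sigma>)"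
      by (simp only: count_def)
    also have "\<dots> = (\<Sum>\<sigma>\<leftarrow>hemisphere e j. G True \<sigma> + G True (map uminus \<sigma>))"
      by (rule sum_hemisphere_coboundary)
    also have "\<dots> = count j"
      unfolding count_def using flip by (intro arg_cong[of _ _ sum_list] map_cong) auto
    finally show ?case using Suc by simp
  qed
  then have c: "count k = 1" by simp
  have sum0: "sum_list (map h xs) = (0::bit)" if "\<And>x. x \<in> set xs \<Longrightarrow> h x = 0" for h and xs :: "'a list list"
    using that by (induction xs) auto
  show ?thesis
  proof (rule ccontr)
    assume "\<not> ?thesis"
    then have "G b \<sigma> = 0" if "\<sigma> \<in> set (hemisphere e k)" for b \<sigma>
      unfolding G_def alt_def using that by (intro sum0) auto
    then have "count k = 0"
      unfolding count_def by (intro sum0) auto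
    with c show False by simp
  qed
qed


section \<open>The Borsuk--Ulam theorem\<close>

lemma borsuk_ulam_cross_polytope:
  fixes f :: "nat \<Rightarrow> 'a::euclidean_space \<Rightarrow> real"
  assumes m: "m < DIM('a)"
    and cont: "\<And>i. i < m \<Longrightarrow> continuous_on cross_polytope (f i)"
    and odd: "\<And>i x. i < m \<Longrightarrow> x \<in> cross_polytope \<Longrightarrow> f i (- x) = - f i x"
  shows "\<exists>x\<in>cross_polytope. \<forall>i<m. f i x = 0"
proof (rule ccontr)
  assume "\<not> ?thesis"
  then have nz: "\<exists>i<m. f i x \<noteq> 0" if "x \<in> cross_polytope" for x
    using that by auto
  obtain e :: "nat \<Rightarrow> 'a" where e: "bij_betw e {..<DIM('a)} Basis"
    using ex_bij_betw_nat_finite[OF finite_Basis] by (auto simp: atLeast0LessThan)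
  define k where "k = DIM('a) - 1"
  have hull: "convex hull (set \<sigma>) \<subseteq> (cross_polytope :: 'a set)"
    if "j \<le> k" "\<sigma> \<in> set (hemisphere e j)" for j \<sigma>
  proof (rule hull_hemisphere_subset_cross_polytope[OF _ _ that(2)])
    have "{..j} \<subseteq> {..<DIM('a)}" using that(1) m by (auto simp: k_def)
    then show "inj_on e {..j}" "e ` {..j} \<subseteq> Basis"
      using e by (auto simp: bij_betw_def intro: inj_on_subset)
  qed
  have ne: "(cross_polytope :: 'a set) \<noteq> {}"
    using hull[of 0 "[e 0]"] by auto
  have mpos: "m > 0" using nz ne by fastforce

  \<comment> \<open>a uniform lower bound, from the minimum of the sum of all \<open>\<bar>f i x\<bar>\<close>\<close>
  obtain \<epsilon> where \<epsilon>: "\<epsilon> > 0" "\<And>x. x \<in> cross_polytope \<Longrightarrow> \<exists>i<m. \<bar>f i x\<bar> \<ge> \<epsilon>"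
  proof -
    have "continuous_on cross_polytope (\<lambda>x. \<Sum>i<m. \<bar>f i x\<bar>)"
      using cont by (intro continuous_intros) auto
    then obtain x0 where x0: "x0 \<in> cross_polytope"
      "\<And>x. x \<in> cross_polytope \<Longrightarrow> (\<Sum>i<m. \<bar>f i x0\<bar>) \<le> (\<Sum>i<m. \<bar>f i x\<bar>)"
      using continuous_attains_inf[OF compact_cross_polytope ne] by metis
    define c where "c = (\<Sum>i<m. \<bar>f i x0\<bar>)"
    have "c > 0" unfolding c_def using nz[OF x0(1)] by (auto intro: sum_pos2)
    moreover have "\<exists>i<m. \<bar>f i x\<bar> \<ge> c / m" if "x \<in> cross_polytope" for x
    proof (rule ccontr)
      assume "\<not> ?thesis"
      then have "(\<Sum>i<m. \<bar>f i x\<bar>) < (\<Sum>i<m. c / m)"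
        using mpos by (intro sum_strict_mono) auto
      then show False using x0(2)[OF that] mpos by (simp add: c_def)
    qed
    ultimately show ?thesis using that[of "c / m"] mpos by auto
  qed

  define idx where "idx = (\<lambda>x. LEAST i. i < m \<and> \<epsilon> \<le> \<bar>f i x\<bar>)"
  define l where "l = (\<lambda>x. (idx x, f (idx x) x > 0))"
  have idx: "idx x < m \<and> \<epsilon> \<le> \<bar>f (idx x) x\<bar>" if "x \<in> cross_polytope" for x
    unfolding idx_def by (rule LeastI_ex) (use \<epsilon>(2)[OF that] in auto)
  have l_uminus: "l (- x) = (fst (l x), \<not> snd (l x))" if x: "x \<in> cross_polytope" for x
  proof -
    have "i < m \<and> \<epsilon> \<le> \<bar>f i (- x)\<bar> \<longleftrightarrow> i < m \<and> \<epsilon> \<le> \<bar>f i x\<bar>" for i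
      using odd[OF _ x, of i] by auto
    then have "idx (- x) = idx x" by (simp add: idx_def)
    then show ?thesis using idx[OF x] odd[OF _ x, of "idx x"] \<epsilon>(1) by (auto simp: l_def)
  qed

  \<comment> \<open>2 bounds the diameter of the cross-polytope, whose points have norm at most 1\<close>
  define mesh where "mesh = (\<lambda>N. (real k / real (Suc k)) ^ N * 2)"
  have "mesh \<longlonglongrightarrow> 0 * 2"
    unfolding mesh_def by (intro tendsto_mult LIMSEQ_realpow_zero tendsto_const) auto
  then have mesh0: "mesh \<longlonglongrightarrow> 0" by simp
  have "\<forall>\<^sub>F N in sequentially. \<forall>i\<in>{..<m}. \<forall>x\<in>cross_polytope. \<forall>y\<in>cross_polytope.
          dist x y \<le> mesh N \<longrightarrow> dist (f i x) (f i y) < \<epsilon>"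
  proof (rule eventually_ball_finite, simp, rule ballI)
    fix i assume "i \<in> {..<m}"
    then have "uniformly_continuous_on cross_polytope (f i)"
      using compact_uniformly_continuous[OF cont compact_cross_polytope] by auto
    then obtain \<delta> where \<delta>: "\<delta> > 0"
      "\<forall>x\<in>cross_polytope. \<forall>x'\<in>cross_polytope. dist x' x < \<delta> \<longrightarrow> dist (f i x') (f i x) < \<epsilon>"
      using \<epsilon>(1) unfolding uniformly_continuous_on_def by metis
    have "\<forall>\<^sub>F N in sequentially. mesh N < \<delta>"
      using order_tendstoD(2)[OF mesh0 \<delta>(1)] .
    then show "\<forall>\<^sub>F N in sequentially. \<forall>x\<in>cross_polytope. \<forall>y\<in>cross_polytope.
          dist x y \<le> mesh N \<longrightarrow> dist (f i x) (f i y) < \<epsilon>"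
      by eventually_elim (use \<delta>(2) in \<open>auto intro: le_less_trans\<close>)
  qed
  then obtain N where N: "\<And>i x y. i < m \<Longrightarrow> x \<in> cross_polytope \<Longrightarrow> y \<in> cross_polytope \<Longrightarrow>
      dist x y \<le> mesh N \<Longrightarrow> dist (f i x) (f i y) < \<epsilon>"
    unfolding eventually_sequentially by (meson lessThan_iff order_refl)

  obtain \<sigma> \<tau> b where \<sigma>: "\<sigma> \<in> set (hemisphere e k)" and \<tau>: "\<tau> \<in> set (iterated_subdivision N \<sigma>)"
    and alt: "alternating b (sorted_signs l \<tau>)"
  proof -
    have "\<exists>\<sigma>\<in>set (hemisphere e k). \<exists>\<tau>\<in>set (iterated_subdivision N \<sigma>).
        \<exists>b. alternating b (sorted_signs l \<tau>)"
      by (rule alternating_simplex_exists[of cross_polytope]) (fact l_uminus, fact hull)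
    then show ?thesis using that by blast
  qed
  have len: "length \<sigma> = Suc k" "length \<tau> = Suc k"
    using length_hemisphere[OF \<sigma>] length_iterated_subdivision[OF \<tau>] by auto
  have sub: "set \<sigma> \<subseteq> cross_polytope" "set \<tau> \<subseteq> cross_polytope"
    using hull[OF _ \<sigma>] hull_subset[of "set \<sigma>" convex] iterated_subdivision_subset_hull[OF \<tau>] by auto
  have "dist v w \<le> 2" if "v \<in> set \<sigma>" "w \<in> set \<sigma>" for v w
  proof -
    have "norm v \<le> 1" "norm w \<le> 1"
      using that sub(1) norm_cross_polytope by auto
    then show ?thesis using norm_triangle_ineq4[of v w] by (simp add: dist_norm)
  qed
  then have small: "dist x y \<le> mesh N" if "x \<in> set \<tau>" "y \<in> set \<tau>" for x y
    using iterated_subdivision_dist_le[OF \<tau> _ that, of 2] len by (auto simp: mesh_def)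

  \<comment> \<open>opposite labels with index \<open>i\<close> would put values of \<open>f i\<close> at distance at least \<open>2 * \<epsilon>\<close>\<close>
  have nocompl: "\<not> ((i, s) \<in> l ` set \<tau> \<and> (i, \<not> s) \<in> l ` set \<tau>)" for i s
  proof
    assume "(i, s) \<in> l ` set \<tau> \<and> (i, \<not> s) \<in> l ` set \<tau>"
    then obtain x y where "x \<in> set \<tau>" "y \<in> set \<tau>" "(i, s) = l x" "(i, \<not> s) = l y"
      by (auto elim!: imageE)
    then have xy: "x \<in> set \<tau>" "y \<in> set \<tau>" "idx x = i" "idx y = i" "(f i x > 0) \<noteq> (f i y > 0)"
      by (auto simp: l_def)
    have in_cp: "x \<in> cross_polytope" "y \<in> cross_polytope"
      using xy(1,2) sub(2) by auto
    have big: "i < m" "\<epsilon> \<le> \<bar>f i x\<bar>" "\<epsilon> \<le> \<bar>f i y\<bar>"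
      using idx[OF in_cp(1)] idx[OF in_cp(2)] xy(3,4) by auto
    have "\<bar>f i x - f i y\<bar> < \<epsilon>"
      using N[OF big(1) in_cp small[OF xy(1,2)]] by (simp only: dist_real_def)
    with big(2,3) xy(5) show False by linarith
  qed
  have "distinct (map fst (sort_key fst (map l \<tau>)))"
    using alt nocompl
    by (intro distinct_if_alternating[of _ b]) (auto simp: sorted_signs_def)
  then have "card (fst ` l ` set \<tau>) = Suc k"
    using distinct_card[of "map fst (sort_key fst (map l \<tau>))"] len(2) by simp
  moreover have "fst ` l ` set \<tau> \<subseteq> {..<m}"
    using idx sub(2) by (auto simp: l_def)
  then have "card (fst ` l ` set \<tau>) \<le> m"
    using card_mono[of "{..<m}"] by auto
  ultimately show False using m by (simp add: k_def)
qed

text \<open>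
  The sphere is reached from the cross-polytope by radial projection, which is odd.
\<close>

theorem borsuk_ulam_common_zero:
  fixes f :: "'i \<Rightarrow> 'a::euclidean_space \<Rightarrow> real"
  assumes I: "finite I" "card I < DIM('a)"
    and cont: "\<And>i. i \<in> I \<Longrightarrow> continuous_on (sphere 0 1) (f i)"
    and odd: "\<And>i x. i \<in> I \<Longrightarrow> x \<in> sphere 0 1 \<Longrightarrow> f i (- x) = - f i x"
  shows "\<exists>x\<in>sphere 0 1. \<forall>i\<in>I. f i x = 0"
proof -
  obtain h where h: "bij_betw h {..<card I} I"
    using ex_bij_betw_nat_finite[OF I(1)] by (auto simp: atLeast0LessThan)
  have sgn: "sgn x \<in> sphere 0 1" if "x \<in> cross_polytope" for x :: 'a
    using that by (auto simp: norm_sgn cross_polytope_def)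
  have hI: "h i \<in> I" if "i < card I" for i
    using h that by (auto simp: bij_betw_def)
  have "\<exists>x\<in>cross_polytope. \<forall>i<card I. f (h i) (sgn x) = 0"
  proof (rule borsuk_ulam_cross_polytope[OF I(2)])
    fix i assume i: "i < card I"
    show "continuous_on cross_polytope (\<lambda>x. f (h i) (sgn x))"
    proof (rule continuous_on_compose2[OF cont[OF hI[OF i]]])
      show "continuous_on (cross_polytope :: 'a set) sgn"
        unfolding sgn_div_norm
        by (intro continuous_intros) (auto simp: cross_polytope_def)
    qed (use sgn in auto)
    show "f (h i) (sgn (- x)) = - f (h i) (sgn x)" if "x \<in> cross_polytope" for x
      using odd[OF hI[OF i] sgn[OF that]] by (simp add: sgn_minus)
  qed
  then obtain x where "x \<in> cross_polytope" "\<forall>i<card I. f (h i) (sgn x) = 0" by auto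
  then show ?thesis
    using h sgn[of x] by (intro bexI[of _ "sgn x"]) (force simp: bij_betw_def)+
qed

section \<open>Bisecting the widths of convex bodies\<close>

lemma support_min_eq_support_max_uminus:
  assumes "compact X" "X \<noteq> {}"
  shows "support_min u X = - support_max (- u) X"
proof -
  obtain x where x: "x \<in> X" "support_min u X = u \<bullet> x" "\<And>y. y \<in> X \<Longrightarrow> u \<bullet> x \<le> u \<bullet> y"
    using support_min_attained[OF assms, of u] by blast
  have "support_max (- u) X = (- u) \<bullet> x"
    by (rule support_max_eqI) (use x in auto)
  then show ?thesis using x by simp
qed

text \<open>
  The support function of a set contained in the ball of radius \<open>B\<close> is \<open>B\<close>-Lipschitz.
\<close>

lemma continuous_on_support_max:
  assumes X: "compact X" "X \<noteq> {}"
  shows "continuous_on S (\<lambda>u. support_max u X)"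
proof -
  obtain B where B: "B > 0" "\<And>x. x \<in> X \<Longrightarrow> norm x \<le> B"
    using compact_imp_bounded[OF X(1)] by (auto simp: bounded_pos)
  have le: "support_max u X - support_max v X \<le> B * dist u v" for u v
  proof -
    obtain x where x: "x \<in> X" "support_max u X = u \<bullet> x"
      using support_max_attained[OF X, of u] by blast
    obtain y where y: "support_max v X = v \<bullet> y" "\<And>z. z \<in> X \<Longrightarrow> v \<bullet> z \<le> v \<bullet> y"
      using support_max_attained[OF X, of v] by blast
    have "support_max u X - support_max v X \<le> (u - v) \<bullet> x"
      using x y(1) y(2)[OF x(1)] by (simp add: inner_diff_left)
    also have "\<dots> \<le> norm (u - v) * norm x" by (rule norm_cauchy_schwarz)
    also have "\<dots> \<le> norm (u - v) * B" by (intro mult_left_mono B x) auto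
    finally show ?thesis by (simp add: dist_norm mult.commute)
  qed
  have "B-lipschitz_on S (\<lambda>u. support_max u X)"
  proof (rule lipschitz_onI)
    show "dist (support_max u X) (support_max v X) \<le> B * dist u v" for u v
      using le[of u v] le[of v u] by (auto simp: dist_real_def dist_commute abs_le_iff)
  qed (use B in auto)
  then show ?thesis by (rule lipschitz_on_continuous_on)
qed

text \<open>
  Convexity supplies the midpoint \<open>z\<close> of a highest and a lowest point of \<open>X\<close>. It lies on the
  cutting hyperplane, so the upper part of \<open>X\<close> has width \<open>u \<bullet> x - t\<close> and the lower part has width
  \<open>t - u \<bullet> y\<close>. The factor \<open>c\<close> serves to normalize \<open>(u, t)\<close> afterwards.
\<close>

lemma bisected_width:
  fixes X :: "(real ^ 'n) set"
  assumes X: "compact X" "convex X" "X \<noteq> {}" and c: "c > 0"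
    and t: "2 * t = support_max u X + support_min u X"
  defines "P \<equiv> X \<inter> halfspace_pos (c *\<^sub>R u, c * t)"
    and "M \<equiv> X \<inter> halfspace_neg (c *\<^sub>R u, c * t)"
  shows "P \<noteq> {}" "M \<noteq> {}"
    "support_max (c *\<^sub>R u) P - support_min (c *\<^sub>R u) P = support_max (c *\<^sub>R u) M - support_min (c *\<^sub>R u) M"
proof -
  obtain x where x: "x \<in> X" "support_max u X = u \<bullet> x" "\<And>z. z \<in> X \<Longrightarrow> u \<bullet> z \<le> u \<bullet> x"
    using support_max_attained[OF X(1,3), of u] by blast
  obtain y where y: "y \<in> X" "support_min u X = u \<bullet> y" "\<And>z. z \<in> X \<Longrightarrow> u \<bullet> y \<le> u \<bullet> z"
    using support_min_attained[OF X(1,3), of u] by blast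
  define z where "z = (1 / 2) *\<^sub>R x + (1 / 2) *\<^sub>R y"
  have z: "z \<in> X" "u \<bullet> z = t"
    using convexD[OF X(2) x(1) y(1), of "1/2" "1/2"] t x y
    by (simp_all add: z_def inner_add_right)
  have tx: "t \<le> u \<bullet> x" "u \<bullet> y \<le> t" using z x y by auto
  have P: "v \<in> P \<longleftrightarrow> v \<in> X \<and> t \<le> u \<bullet> v" and M: "v \<in> M \<longleftrightarrow> v \<in> X \<and> u \<bullet> v \<le> t" for v
    using c by (auto simp: P_def M_def halfspace_pos_def halfspace_neg_def)
  show "P \<noteq> {}" "M \<noteq> {}" using P[of z] M[of z] z by auto
  have "support_max (c *\<^sub>R u) P = (c *\<^sub>R u) \<bullet> x" "support_min (c *\<^sub>R u) M = (c *\<^sub>R u) \<bullet> y"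
    "support_min (c *\<^sub>R u) P = (c *\<^sub>R u) \<bullet> z" "support_max (c *\<^sub>R u) M = (c *\<^sub>R u) \<bullet> z"
    by (rule support_max_eqI support_min_eqI; use P M x y z tx c in auto)+
  moreover have "u \<bullet> x - t = t - u \<bullet> y" using t x y by simp
  then have "c * (u \<bullet> x - t) = c * (t - u \<bullet> y)" by simp
  ultimately show "support_max (c *\<^sub>R u) P - support_min (c *\<^sub>R u) P
      = support_max (c *\<^sub>R u) M - support_min (c *\<^sub>R u) M"
    using z by (simp add: algebra_simps)
qed

theorem theorem4p1:
  fixes A :: "'n::finite \<Rightarrow> (real ^ 'n) set"
  assumes "\<And>i. compact (A i)"
    and "\<And>i. convex (A i)"
    and "\<And>i. interior (A i) \<noteq> {}"
  shows "\<exists>(u :: real ^ 'n) (t :: real). (u, t) \<in> sphere (0, 0) 1 \<and>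
    (\<forall>i. A i \<inter> halfspace_pos (u, t) \<noteq> {} \<and>
         A i \<inter> halfspace_neg (u, t) \<noteq> {} \<and>
         support_max u (A i \<inter> halfspace_pos (u, t)) - support_min u (A i \<inter> halfspace_pos (u, t)) =
         support_max u (A i \<inter> halfspace_neg (u, t)) - support_min u (A i \<inter> halfspace_neg (u, t)))"
proof -
  have ne: "A i \<noteq> {}" for i using assms(3)[of i] by auto
  define mid where "mid = (\<lambda>i u. (support_max u (A i) - support_max (- u) (A i)) / 2)"
  have mid: "2 * mid i u = support_max u (A i) + support_min u (A i)" for i u
    using support_min_eq_support_max_uminus[OF assms(1) ne] by (simp add: mid_def)
  \<comment> \<open>an arbitrary index with which all others are compared\<close>
  fix i0 :: 'n
  have "\<exists>u\<in>sphere 0 1. \<forall>i\<in>- {i0}. mid i u - mid i0 u = 0"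
  proof (rule borsuk_ulam_common_zero)
    have "card (- {i0}) = CARD('n) - 1" by (simp add: Compl_eq_Diff_UNIV)
    then show "card (- {i0}) < DIM(real ^ 'n)" by simp
    have "continuous_on (sphere 0 1) (\<lambda>u. support_max (- u) (A i))" for i
      by (rule continuous_on_compose2[OF continuous_on_support_max[OF assms(1) ne, of UNIV]])
         (auto intro: continuous_intros)
    then show "continuous_on (sphere 0 1) (\<lambda>u. mid i u - mid i0 u)" for i
      unfolding mid_def by (intro continuous_intros continuous_on_support_max[OF assms(1) ne]) auto
    show "mid i (- u) - mid i0 (- u) = - (mid i u - mid i0 u)" for i u
      by (simp add: mid_def field_simps)
  qed simp
  then obtain u where u: "norm u = 1" "\<And>i. mid i u = mid i0 u" by fastforce
  define t where "t = mid i0 u"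
  define c where "c = inverse (norm (u, t))"
  have "(u, t) \<noteq> (0, 0)" using u(1) by auto
  then have "c > 0" unfolding c_def zero_prod_def[symmetric] by simp
  have "norm (c *\<^sub>R u, c * t) = c * norm (u, t)"
    using norm_scaleR[of c "(u, t)"] \<open>c > 0\<close> by simp
  also have "\<dots> = 1" using \<open>c > 0\<close> by (simp add: c_def)
  finally have "(c *\<^sub>R u, c * t) \<in> sphere (0, 0) 1"
    by (simp only: mem_sphere zero_prod_def[symmetric] dist_0_norm)
  moreover have "2 * t = support_max u (A i) + support_min u (A i)" for i
    using mid[of i u] u(2)[of i] by (simp add: t_def)
  ultimately show ?thesis
    using bisected_width[OF assms(1,2) ne \<open>c > 0\<close>] by (intro exI conjI allI) auto
qed

end
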